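(* Let $(G,\rho)$ be a Polish metric space which is dense-in-itself, and let $\mu$ be a diffused $\sigma$-finite non-finite Borel measure defined in $(G,\rho)$. Then there exist a metric $\rho_{\varphi}$, a group operation $\odot_{\varphi}$ in $G$ and a Borel measure $\mu^\star$ in $G$ such that the following conditions hold: (i) the class of Borel measurable subsets of $G$ generated by the metric $\rho_{\varphi}$ coincides with the class of Borel measurable subsets of $G$ generated by the metric $\rho$; (ii) $(G,\rho_{\varphi},\odot_{\varphi})$ is a non-compact locally compact Polish group; (iii) the measures $\mu^\star$ and $\mu$ are equivalent; (iv) $\mu^\star$ is a two-sided invariant (in particular left invariant and right invariant) $\sigma$-finite non-finite Haar measure in $(G,\rho_{\varphi},\odot_{\varphi})$.
   Context: A Polish metric space is a complete separable metric space. A space is dense-in-itself if it has no isolated points. A measure is diffused if it vanishes on all singletons; it is non-finite if the whole space has infinite measure. Two Borel measures are equivalent if they have the same null sets (each is absolutely continuous with respect to the other). A Polish group $(G,\rho,\odot)$ is a group $(G,\odot)$ with a complete separable metric $\rho$ such that the map $G\times G\to G$, $(x,y)\mapsto x^{-1}\odot y$, is continuous; compactness and local compactness refer to the metric topology. A Borel measure $\mu$ on a Polish group is left invariant if $\mu(g\odot E)=\mu(E)$, right invariant if $\mu(E\odot g)=\mu(E)$, and two-sided invariant if $\mu(g_1\odot E\odot g_2)=\mu(E)$, for all group elements $g,g_1,g_2$ and all Borel sets $E$. A left (right, two-sided) invariant Haar measure in a locally compact Polish group is a Borel measure $\mu$ that is: diffused; left (right, two-sided) invariant; outer regular ($\mu(E)=\inf\{\mu(U):E\subseteq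 U,\ U\text{ open}\}$ for every Borel $E$); inner regular ($\mu(E)=\sup\{\mu(F):F\subseteq E,\ F\text{ compact}\}$ for every Borel $E$); and finite on every compact set. *)

theory Defs
  imports "HOL-Analysis.Analysis" "HOL-Algebra.Coset"
begin

definition polish_metric :: "'a metric \<Rightarrow> bool" where
  "polish_metric m \<longleftrightarrow> mcomplete_of m \<and> separable_space (mtopology_of m)"

definition dense_in_itself :: "'a topology \<Rightarrow> bool" where
  "dense_in_itself X \<longleftrightarrow> (\<forall>x\<in>topspace X. \<not> openin X {x})"

text \<open>Only the underlying \<open>\<sigma>\<close>-algebra of this measure space is used.\<close>

definition metric_borel :: "'a metric \<Rightarrow> 'a measure" where
  "metric_borel m = sigma (mspace m) {U. openin (mtopology_of m) U}"

definition borel_measure_on :: "'a metric \<Rightarrow> 'a measure \<Rightarrow> bool" where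
  "borel_measure_on m \<mu> \<longleftrightarrow> sets \<mu> = sets (metric_borel m)"

definition diffused :: "'a measure \<Rightarrow> bool" where
  "diffused \<mu> \<longleftrightarrow> (\<forall>x\<in>space \<mu>. emeasure \<mu> {x} = 0)"

definition non_finite :: "'a measure \<Rightarrow> bool" where
  "non_finite \<mu> \<longleftrightarrow> emeasure \<mu> (space \<mu>) = \<infinity>"

definition equivalent_measures :: "'a measure \<Rightarrow> 'a measure \<Rightarrow> bool" where
  "equivalent_measures \<mu> \<nu> \<longleftrightarrow> absolutely_continuous \<mu> \<nu> \<and> absolutely_continuous \<nu> \<mu>"

text \<open>The group is a record with its own carrier, which has to be the point set of the metric.\<close>

definition polish_group :: "'a metric \<Rightarrow> 'a monoid \<Rightarrow> bool" where
  "polish_group m G \<longleftrightarrow>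
     group G \<and> carrier G = mspace m \<and> polish_metric m \<and>
     continuous_map (prod_topology (mtopology_of m) (mtopology_of m)) (mtopology_of m)
       (\<lambda>(x, y). inv\<^bsub>G\<^esub> x \<otimes>\<^bsub>G\<^esub> y)"

definition left_invariant :: "'a monoid \<Rightarrow> 'a measure \<Rightarrow> bool" where
  "left_invariant G \<mu> \<longleftrightarrow>
     (\<forall>g\<in>carrier G. \<forall>E\<in>sets \<mu>. emeasure \<mu> (g <#\<^bsub>G\<^esub> E) = emeasure \<mu> E)"

definition right_invariant :: "'a monoid \<Rightarrow> 'a measure \<Rightarrow> bool" where
  "right_invariant G \<mu> \<longleftrightarrow>
     (\<forall>g\<in>carrier G. \<forall>E\<in>sets \<mu>. emeasure \<mu> (E #>\<^bsub>G\<^esub> g) = emeasure \<mu> E)"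

definition two_sided_invariant :: "'a monoid \<Rightarrow> 'a measure \<Rightarrow> bool" where
  "two_sided_invariant G \<mu> \<longleftrightarrow>
     (\<forall>g1\<in>carrier G. \<forall>g2\<in>carrier G. \<forall>E\<in>sets \<mu>.
        emeasure \<mu> ((g1 <#\<^bsub>G\<^esub> E) #>\<^bsub>G\<^esub> g2) = emeasure \<mu> E)"

definition outer_regular :: "'a metric \<Rightarrow> 'a measure \<Rightarrow> bool" where
  "outer_regular m \<mu> \<longleftrightarrow>
     (\<forall>E\<in>sets \<mu>. emeasure \<mu> E = (INF U\<in>{U. E \<subseteq> U \<and> openin (mtopology_of m) U}. emeasure \<mu> U))"

definition inner_regular :: "'a metric \<Rightarrow> 'a measure \<Rightarrow> bool" where
  "inner_regular m \<mu> \<longleftrightarrow>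
     (\<forall>E\<in>sets \<mu>. emeasure \<mu> E = (SUP F\<in>{F. F \<subseteq> E \<and> compactin (mtopology_of m) F}. emeasure \<mu> F))"

definition finite_on_compacts :: "'a metric \<Rightarrow> 'a measure \<Rightarrow> bool" where
  "finite_on_compacts m \<mu> \<longleftrightarrow> (\<forall>K. compactin (mtopology_of m) K \<longrightarrow> emeasure \<mu> K < \<infinity>)"

text \<open>The parameter \<open>Inv\<close> is one of the three invariance predicates above.\<close>

definition haar_measure ::
    "('a monoid \<Rightarrow> 'a measure \<Rightarrow> bool) \<Rightarrow> 'a metric \<Rightarrow> 'a monoid \<Rightarrow> 'a measure \<Rightarrow> bool" where
  "haar_measure Inv m G \<mu> \<longleftrightarrow>
     polish_group m G \<and> locally_compact_space (mtopology_of m) \<and> borel_measure_on m \<mu> \<and>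
     diffused \<mu> \<and> Inv G \<mu> \<and> outer_regular m \<mu> \<and> inner_regular m \<mu> \<and> finite_on_compacts m \<mu>"

end

theory Submission
  imports Defs "HOL-Probability.Weak_Convergence"
begin

text \<open>
  Every diffused, non-zero, \<open>\<sigma>\<close>-finite Borel measure on a Polish space looks, up to a Borel bijection
  and up to equivalence, like Lebesgue measure on the real line.  Once a Borel bijection \<open>f\<close> onto the
  line is known that matches the null sets of \<open>\<mu>\<close> with the Lebesgue null sets, the metric, the addition
  and the Lebesgue measure of the line are pulled back along \<open>f\<close>.  The space thereby becomes a copy of
  the locally compact, non-compact group of reals with its Haar measure.

  The bijection has to be exact, not just almost everywhere defined, and this is where the work lies.

  Recording in base 4 to which balls of a countable base a point belongs embeds a Polish space into
  the line (\<open>polish_embeds_null\<close>).  By completeness the point can be recovered by a Borel map from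
  its code, so the image of the code is Borel.  All codes lie in a Cantor-like null set.

  A Borel version of the Schroeder-Bernstein argument (\<open>borel_schroeder_bernstein\<close>) makes two spaces
  isomorphic as soon as each embeds into the other.  A Borel set \<open>A\<close> of positive measure for some
  diffused probability contains a copy of the line: it contains a compact \<open>K\<close> of positive measure, and
  the quantile function of the probability conditioned on \<open>K\<close> is an injection of \<open>(0, 1)\<close> into \<open>K\<close>
  (\<open>real_line_retract_of_positive\<close>).  Hence the whole space is Borel isomorphic to the line.

  For a diffused probability \<open>P\<close> on the line, the distribution function is a left inverse of the
  quantile function, so it carries a set of full \<open>P\<close>-measure bijectively onto a subset of \<open>(0, 1)\<close>
  of full measure.  Both exceptional sets can be enlarged so that they contain a copy of the line,
  by giving up the null Cantor set and its image.  They are then isomorphic to each other, and any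
  isomorphism between them repairs the map on the null sets (\<open>isomorphic_uniform_real\<close>).  Doing this for a
  probability equivalent to \<open>\<mu>\<close> and for one equivalent to Lebesgue measure gives the bijection
  (\<open>isomorphic_lebesgue\<close>).
\<close>

section \<open>Borel retracts and isomorphisms\<close>

text \<open>
  An embedding is always given together with a measurable left inverse on the whole target space.
  When the target has a measurable diagonal, this says that the image of the embedding is a measurable set and
  that the embedding is an isomorphism onto it, while composition stays trivial.
\<close>

definition borel_retract :: "'a measure \<Rightarrow> 'b measure \<Rightarrow> bool" where
  "borel_retract M N \<longleftrightarrow>
     (\<exists>f g. f \<in> M \<rightarrow>\<^sub>M N \<and> g \<in> N \<rightarrow>\<^sub>M M \<and> (\<forall>x\<in>space M. g (f x) = x))"

definition borel_isomorphic :: "'a measure \<Rightarrow> 'b measure \<Rightarrow> bool" where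
  "borel_isomorphic M N \<longleftrightarrow>
     (\<exists>f g. f \<in> M \<rightarrow>\<^sub>M N \<and> g \<in> N \<rightarrow>\<^sub>M M \<and> (\<forall>x\<in>space M. g (f x) = x) \<and> (\<forall>y\<in>space N. f (g y) = y))"

lemma borel_retract_trans:
  assumes "borel_retract L M" "borel_retract M N"
  shows "borel_retract L N"
proof -
  from assms(1) obtain f g where fg: "f \<in> L \<rightarrow>\<^sub>M M" "g \<in> M \<rightarrow>\<^sub>M L" "\<forall>x\<in>space L. g (f x) = x"
    unfolding borel_retract_def by blast
  from assms(2) obtain f' g' where fg': "f' \<in> M \<rightarrow>\<^sub>M N" "g' \<in> N \<rightarrow>\<^sub>M M" "\<forall>x\<in>space M. g' (f' x) = x"
    unfolding borel_retract_def by blast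
  have "f' \<circ> f \<in> L \<rightarrow>\<^sub>M N" "g \<circ> g' \<in> N \<rightarrow>\<^sub>M L"
    using fg fg' by (auto intro: measurable_comp)
  moreover have "\<forall>x\<in>space L. (g \<circ> g') ((f' \<circ> f) x) = x"
    using fg fg' by (auto dest: measurable_space)
  ultimately show ?thesis unfolding borel_retract_def by blast
qed

text \<open>
  The classical proof works measurably.  With \<open>f\<close> embedding \<open>M\<close> into the line and \<open>i\<close> embedding the line
  into \<open>M\<close>, let \<open>B\<close> be the set of points whose backward orbit under \<open>i\<close> and \<open>f\<close> ends in \<open>M\<close> outside the image
  of \<open>i\<close>.  Use \<open>f\<close> on \<open>B\<close> and the inverse of \<open>i\<close> elsewhere.  The stages of \<open>B\<close> are measurable because
  membership in an image is an equation between measurable maps.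
\<close>

theorem borel_schroeder_bernstein:
  assumes "borel_retract M (borel :: real measure)" "borel_retract (borel :: real measure) M"
  shows "borel_isomorphic M (borel :: real measure)"
proof -
  obtain f :: "'a \<Rightarrow> real" and g
    where f[measurable]: "f \<in> borel_measurable M" and g[measurable]: "g \<in> borel \<rightarrow>\<^sub>M M"
      and gf: "\<And>x. x \<in> space M \<Longrightarrow> g (f x) = x"
    using assms(1) unfolding borel_retract_def by blast
  obtain i :: "real \<Rightarrow> 'a" and j
    where i[measurable]: "i \<in> borel \<rightarrow>\<^sub>M M" and j[measurable]: "j \<in> borel_measurable M"
      and ji: "\<And>r. j (i r) = r"
    using assms(2) unfolding borel_retract_def space_borel by (blast intro: UNIV_I)
  have gM: "g r \<in> space M" and iM: "i r \<in> space M" for r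
    using measurable_space[OF g] measurable_space[OF i] by auto
  \<comment> \<open>The image of \<open>i\<close>; the equation is stated after applying \<open>f\<close> so that it compares measurable real functions.\<close>
  define E where "E = {x \<in> space M. f (i (j x)) = f x}"
  have E_eq: "E = {x \<in> space M. i (j x) = x}"
  proof -
    have "i (j x) = x" if "x \<in> space M" "f (i (j x)) = f x" for x
      using gf[OF iM[of "j x"]] gf[OF that(1)] that(2) by simp
    then show ?thesis unfolding E_def by auto
  qed
  define A where "A = rec_nat (space M - E) (\<lambda>_ X. {x \<in> space M. x \<in> E \<and> f (g (j x)) = j x \<and> g (j x) \<in> X})"
  have A0: "A 0 = space M - E" and AS: "A (Suc n) = {x \<in> space M. x \<in> E \<and> f (g (j x)) = j x \<and> g (j x) \<in> A n}" for n
    by (auto simp: A_def)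
  have E[measurable]: "E \<in> sets M" unfolding E_def by measurable
  have An[measurable]: "A n \<in> sets M" for n
  proof (induction n)
    case 0
    show ?case unfolding A0 by measurable
  next
    case (Suc n)
    note Suc[measurable]
    show ?case unfolding AS by measurable
  qed
  define B where "B = (\<Union>n. A n)"
  have B[measurable]: "B \<in> sets M" unfolding B_def by measurable
  have B_iff: "i r \<in> B \<longleftrightarrow> f (g r) = r \<and> g r \<in> B" for r
  proof
    assume "i r \<in> B"
    then obtain n where n: "i r \<in> A n" unfolding B_def by blast
    then show "f (g r) = r \<and> g r \<in> B"
      by (cases n) (auto simp: A0 AS E_eq ji iM B_def)
  next
    assume "f (g r) = r \<and> g r \<in> B"
    then obtain n where "f (g r) = r" "g r \<in> A n" unfolding B_def by blast
    then have "i r \<in> A (Suc n)" by (auto simp: AS E_eq ji iM)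
    then show "i r \<in> B" unfolding B_def by blast
  qed
  define h where "h x = (if x \<in> B then f x else j x)" for x
  define k where "k r = (if i r \<in> B then g r else i r)" for r
  have "h \<in> borel_measurable M" unfolding h_def by measurable
  moreover have "k \<in> borel \<rightarrow>\<^sub>M M" unfolding k_def by measurable
  moreover have "k (h x) = x" if x: "x \<in> space M" for x
  proof (cases "x \<in> B")
    case True
    then show ?thesis by (auto simp: h_def k_def gf x B_iff)
  next
    case False
    then have "x \<notin> A 0" unfolding B_def by blast
    then have "i (j x) = x" using x by (auto simp: A0 E_eq)
    then show ?thesis using False by (simp add: h_def k_def)
  qed
  moreover have "h (k r) = r" for r
    using B_iff[of r] by (auto simp: h_def k_def ji)
  ultimately show ?thesis unfolding borel_isomorphic_def by blast
qed

section \<open>A null set of codes for sequences of bits\<close>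

text \<open>
  Bits are used as base 4 digits.  Since only the digits 0 and 1 occur, the tail of such an expansion is
  at most \<open>1/3\<close>, so every digit can be read off with the floor function, and different sequences of bits have different codes.
\<close>

definition quaternary :: "(nat \<Rightarrow> bool) \<Rightarrow> real" where
  "quaternary b = (\<Sum>n. of_bool (b n) / 4 ^ Suc n)"

definition quaternary_digit :: "nat \<Rightarrow> real \<Rightarrow> int" where
  "quaternary_digit n r = \<lfloor>4 * ((\<lambda>x. frac (4 * x)) ^^ n) r\<rfloor>"

definition quaternary_cantor :: "real set" where
  "quaternary_cantor = {r \<in> {0..1}. \<forall>n. quaternary_digit n r = 0 \<or> quaternary_digit n r = 1}"

lemma summable_quaternary: "summable (\<lambda>n. of_bool (b n) / 4 ^ Suc n :: real)"
proof (rule summable_comparison_test')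
  show "summable (\<lambda>n. (1/4) ^ n :: real)" by (rule summable_geometric) simp
  show "norm (of_bool (b n) / 4 ^ Suc n :: real) \<le> (1 / 4) ^ n" for n
    by (simp add: power_divide divide_simps)
qed

lemma quaternary_bounds: "0 \<le> quaternary b" "quaternary b \<le> 1 / 3"
proof -
  show "0 \<le> quaternary b"
    unfolding quaternary_def by (intro suminf_nonneg summable_quaternary) auto
  have s: "(\<lambda>n. (1/4) * (1/4) ^ n :: real) sums ((1/4) * (1 / (1 - 1/4)))"
    by (intro sums_mult geometric_sums) simp
  have "quaternary b \<le> (\<Sum>n. (1/4) * (1/4) ^ n)"
    unfolding quaternary_def
    by (intro suminf_le summable_quaternary sums_summable[OF s]) (auto simp: power_divide divide_simps)
  also have "\<dots> = 1 / 3" using sums_unique[OF s] by simp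
  finally show "quaternary b \<le> 1 / 3" .
qed

lemma quaternary_pos: "b n \<Longrightarrow> 0 < quaternary b"
  unfolding quaternary_def by (rule suminf_pos2[where i = n]) (use summable_quaternary in auto)

lemma quaternary_shift: "4 * quaternary b = of_bool (b 0) + quaternary (\<lambda>n. b (Suc n))"
proof -
  have "quaternary b = of_bool (b 0) / 4 + (\<Sum>n. of_bool (b (Suc n)) / 4 ^ Suc (Suc n))"
    unfolding quaternary_def using suminf_split_head[OF summable_quaternary[of b]] by simp
  also have "(\<Sum>n. of_bool (b (Suc n)) / 4 ^ Suc (Suc n) :: real) = quaternary (\<lambda>n. b (Suc n)) / 4"
    unfolding quaternary_def
    by (subst suminf_divide[OF summable_quaternary, symmetric]) (simp add: field_simps)
  finally show ?thesis by simp
qed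

lemma floor_quaternary: "\<lfloor>4 * quaternary b\<rfloor> = of_bool (b 0)"
  using quaternary_bounds[of "\<lambda>n. b (Suc n)"] unfolding quaternary_shift[of b]
  by (cases "b 0") (auto simp: floor_eq_iff)

lemma frac_quaternary: "frac (4 * quaternary b) = quaternary (\<lambda>n. b (Suc n))"
  unfolding frac_def floor_quaternary by (simp add: quaternary_shift[of b])

lemma quaternary_digit_quaternary: "quaternary_digit n (quaternary b) = of_bool (b n)"
proof -
  have "((\<lambda>x. frac (4 * x)) ^^ n) (quaternary b) = quaternary (\<lambda>k. b (k + n))"
    by (induction n) (simp_all add: frac_quaternary)
  then show ?thesis by (simp add: quaternary_digit_def floor_quaternary)
qed

lemma pred_quaternary_digit[measurable]:
  "Measurable.pred borel (\<lambda>r. quaternary_digit n r = k)"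
proof -
  have "(\<lambda>x::real. frac (4 * x)) ^^ n \<in> borel_measurable borel"
  proof (induction n)
    case (Suc n)
    note Suc[measurable]
    show ?case unfolding funpow.simps comp_def frac_def by measurable
  qed (auto simp: id_def)
  note this[measurable]
  show ?thesis unfolding quaternary_digit_def floor_eq_iff by measurable
qed

lemma quaternary_in_cantor: "quaternary b \<in> quaternary_cantor"
  using quaternary_bounds[of b] by (auto simp: quaternary_cantor_def quaternary_digit_quaternary)

text \<open>
  The set \<open>K\<close> is covered by two copies of itself shrunk by the factor 4, one for each first digit.
  Its finite measure is therefore at most half of itself.
\<close>

lemma null_quaternary_cantor: "quaternary_cantor \<in> null_sets lborel"
proof -
  let ?K = quaternary_cantor
  have K[measurable]: "?K \<in> sets borel" unfolding quaternary_cantor_def by measurable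
  have scale: "emeasure lborel ?K = 4 * emeasure lborel ((\<lambda>x. t + 4 * x) -` ?K)" for t :: real
  proof -
    have "emeasure lborel ?K = emeasure (density (distr lborel borel (\<lambda>x. t + 4 * x)) (\<lambda>_. ennreal \<bar>4\<bar>)) ?K"
      by (subst lborel_real_affine[of 4 t]) auto
    also have "\<dots> = 4 * emeasure lborel ((\<lambda>x. t + 4 * x) -` ?K)"
      by (subst emeasure_density_const) (auto simp: emeasure_distr)
    finally show ?thesis .
  qed
  have sub: "?K \<subseteq> ((\<lambda>x. 0 + 4 * x) -` ?K) \<union> ((\<lambda>x. - 1 + 4 * x) -` ?K)"
  proof
    fix r assume r: "r \<in> ?K"
    have dig: "quaternary_digit n (frac (4 * r)) = quaternary_digit (Suc n) r" for n
      by (simp add: quaternary_digit_def funpow_Suc_right del: funpow.simps)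
    have "frac (4 * r) \<in> ?K"
      using r frac_ge_0[of "4 * r"] frac_lt_1[of "4 * r"]
      by (auto simp: quaternary_cantor_def dig intro: less_imp_le)
    moreover have "\<lfloor>4 * r\<rfloor> \<in> {0, 1}"
      using r unfolding quaternary_cantor_def quaternary_digit_def by (auto dest!: spec[of _ 0])
    then have "frac (4 * r) \<in> {0 + 4 * r, - 1 + 4 * r}" by (auto simp: frac_def)
    ultimately show "r \<in> ((\<lambda>x. 0 + 4 * x) -` ?K) \<union> ((\<lambda>x. - 1 + 4 * x) -` ?K)" by auto
  qed
  have [measurable]: "(\<lambda>x::real. t + 4 * x) -` ?K \<in> sets borel" for t
    by (rule measurable_sets_borel[OF _ K]) measurable
  have "emeasure lborel ?K \<le> emeasure lborel ((\<lambda>x. 0 + 4 * x) -` ?K) + emeasure lborel ((\<lambda>x. - 1 + 4 * x) -` ?K)"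
    by (rule order_trans[OF emeasure_mono[OF sub] emeasure_subadditive]) (unfold sets_lborel, measurable)
  then have "4 * emeasure lborel ?K \<le> 2 * emeasure lborel ?K"
    using scale[of 0] scale[of "-1"] by (smt (verit) distrib_left mult_left_mono mult_2 zero_le)
  moreover have "emeasure lborel ?K < \<infinity>"
    by (rule le_less_trans[OF emeasure_mono[of _ "{0..1}"]]) (auto simp: quaternary_cantor_def)
  ultimately have "emeasure lborel ?K = 0"
    by (cases "emeasure lborel ?K") (auto simp: ennreal_mult'[symmetric] simp flip: ennreal_numeral)
  then show ?thesis by auto
qed

section \<open>Embedding Polish spaces into the line\<close>

lemma space_metric_borel [simp]: "space (metric_borel m) = mspace m"
  unfolding metric_borel_def by (rule space_measure_of) (use openin_subset[of "mtopology_of m"] in auto)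

lemma sets_metric_borel_open: "openin (mtopology_of m) U \<Longrightarrow> U \<in> sets (metric_borel m)"
  unfolding metric_borel_def using openin_subset[of "mtopology_of m"] by (subst sets_measure_of) auto

lemma measurable_metric_borelI:
  assumes "\<And>x. x \<in> space N \<Longrightarrow> f x \<in> mspace m"
    and "\<And>U. openin (mtopology_of m) U \<Longrightarrow> f -` U \<inter> space N \<in> sets N"
  shows "f \<in> N \<rightarrow>\<^sub>M metric_borel m"
  unfolding metric_borel_def
  by (rule measurable_measure_of) (use assms openin_subset[of "mtopology_of m"] in auto)

lemma separable_dense_sequence:
  assumes "separable_space (mtopology_of m)" "mspace m \<noteq> {}"
  obtains D :: "nat \<Rightarrow> 'a"
  where "\<And>n. D n \<in> mspace m" "\<And>x e. x \<in> mspace m \<Longrightarrow> 0 < e \<Longrightarrow> \<exists>n. mdist m (D n) x < e"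
proof -
  interpret Metric_space "mspace m" "mdist m" by simp
  obtain C where C: "countable C" "C \<subseteq> mspace m" "mtopology_of m closure_of C = mspace m"
    using assms(1) unfolding separable_space_def by auto
  with assms(2) have "C \<noteq> {}" by (metis closure_of_empty)
  have D: "range (from_nat_into C) = C" using C(1) \<open>C \<noteq> {}\<close> by (rule range_from_nat_into[rotated])
  show ?thesis
  proof
    show "from_nat_into C n \<in> mspace m" for n using D C(2) by blast
    show "\<exists>n. mdist m (from_nat_into C n) x < e" if xe: "x \<in> mspace m" "0 < e" for x e
    proof -
      have "x \<in> mtopology closure_of C" using C(3) xe by (simp add: mtopology_of_def)
      then obtain y where "y \<in> C" "y \<in> mball x e"
        using xe(2) unfolding metric_closure_of by blast
      then show ?thesis using D by (metis commute in_mball imageE)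
    qed
  qed
qed

text \<open>
  The code of \<open>x\<close> lists the pairs \<open>(k, i)\<close> for which \<open>x\<close> is closer than \<open>(1/2)^k\<close> to the \<open>i\<close>-th point of a dense
  sequence.  A real number is \<open>good\<close> if its digits look like such a list: there is a ball of every radius, and any two
  listed balls have centres as close as intersecting balls must have.  The first listed
  centres then form a Cauchy sequence, and its limit decodes the number.  The decoding is Borel because the
  distances from it to fixed points are limits of Borel functions.
\<close>

theorem polish_embeds_null:
  fixes m :: "'a metric"
  assumes "polish_metric m" "mspace m \<noteq> {}"
  obtains f :: "'a \<Rightarrow> real" and g
  where "f \<in> borel_measurable (metric_borel m)" "g \<in> borel \<rightarrow>\<^sub>M metric_borel m"
    "\<And>x. x \<in> mspace m \<Longrightarrow> g (f x) = x" "\<And>x. x \<in> mspace m \<Longrightarrow> f x \<in> quaternary_cantor \<inter> {0<..<1}"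
proof -
  interpret Metric_space "mspace m" "mdist m" by simp
  have complete: "mcomplete" and separable: "separable_space (mtopology_of m)"
    using assms(1) by (auto simp: polish_metric_def mcomplete_of_def)
  obtain D :: "nat \<Rightarrow> 'a" where D: "\<And>n. D n \<in> mspace m"
    and dense: "\<And>x e. x \<in> mspace m \<Longrightarrow> 0 < e \<Longrightarrow> \<exists>n. mdist m (D n) x < e"
    using separable_dense_sequence[OF separable assms(2)] by blast
  define e where "e k = (1 / 2 :: real) ^ k" for k
  have e0: "0 < e k" for k by (simp add: e_def)
  have e_lim: "e \<longlonglongrightarrow> 0" unfolding e_def by (rule LIMSEQ_power_zero) simp
  define near where "near x k i \<longleftrightarrow> mdist m (D i) x < e k" for x k i
  define f where "f x = quaternary (\<lambda>n. near x (fst (prod_decode n)) (snd (prod_decode n)))" for x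
  define bit where "bit r k i \<longleftrightarrow> quaternary_digit (prod_encode (k, i)) r = 1" for r k i
  have bit_f: "bit (f x) k i \<longleftrightarrow> near x k i" for x k i
    by (simp add: bit_def f_def quaternary_digit_quaternary)
  have [measurable]: "Measurable.pred borel (\<lambda>r. bit r k i)" for k i
    unfolding bit_def by measurable
  define good where "good r \<longleftrightarrow> (\<forall>k. \<exists>i. bit r k i) \<and>
    (\<forall>k i l j. bit r k i \<longrightarrow> bit r l j \<longrightarrow> mdist m (D i) (D j) < e k + e l)" for r
  have [measurable]: "Measurable.pred borel good" unfolding good_def by measurable
  define a where "a r k = (LEAST i. bit r k i)" for r k
  have [measurable]: "(\<lambda>r. a r k) \<in> borel \<rightarrow>\<^sub>M count_space UNIV" for k
    unfolding a_def by measurable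
  have bit_a: "bit r k (a r k)" if "good r" for r k
    unfolding a_def using that by (auto simp: good_def intro: LeastI_ex)
  \<comment> \<open>The value \<open>D 0\<close> outside the good numbers only makes the decoding total.\<close>
  define g where "g r = (if good r then SOME x. limitin mtopology (\<lambda>k. D (a r k)) x sequentially else D 0)" for r
  have g_lim: "limitin mtopology (\<lambda>k. D (a r k)) (g r) sequentially" if "good r" for r
  proof -
    have "MCauchy (\<lambda>k. D (a r k))"
      unfolding MCauchy_def
    proof (intro conjI allI impI)
      show "range (\<lambda>k. D (a r k)) \<subseteq> mspace m" using D by auto
      fix \<epsilon> :: real assume "\<epsilon> > 0"
      then obtain N where N: "\<And>n. n \<ge> N \<Longrightarrow> e n < \<epsilon> / 2"
        using order_tendstoD(2)[OF e_lim, of "\<epsilon> / 2"] by (auto simp: eventually_sequentially)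
      have "mdist m (D (a r n)) (D (a r n')) < \<epsilon>" if "N \<le> n" "N \<le> n'" for n n'
        using N[OF that(1)] N[OF that(2)] bit_a[OF \<open>good r\<close>, of n] bit_a[OF \<open>good r\<close>, of n'] \<open>good r\<close>
        unfolding good_def by fastforce
      then show "\<exists>N. \<forall>n n'. N \<le> n \<longrightarrow> N \<le> n' \<longrightarrow> mdist m (D (a r n)) (D (a r n')) < \<epsilon>" by blast
    qed
    then obtain x where "limitin mtopology (\<lambda>k. D (a r k)) x sequentially"
      using complete unfolding mcomplete_def by blast
    then show ?thesis using \<open>good r\<close> by (auto simp: g_def intro: someI)
  qed
  have g_space: "g r \<in> mspace m" for r
    using limitin_mspace[OF g_lim] D by (cases "good r") (auto simp: g_def)
  have good_f: "good (f x)" and gf: "g (f x) = x" if x: "x \<in> mspace m" for x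
  proof -
    show good: "good (f x)"
      unfolding good_def bit_f
    proof (intro conjI allI impI)
      show "\<exists>i. near x k i" for k using dense[OF x e0] by (auto simp: near_def)
      show "mdist m (D i) (D j) < e k + e l" if "near x k i" "near x l j" for k i l j
        using that triangle[OF D[of i] x D[of j]] by (simp add: near_def commute)
    qed
    have "near x k (a (f x) k)" for k using bit_a[OF good] by (simp add: bit_f)
    then have "(\<lambda>k. mdist m (D (a (f x) k)) x) \<longlonglongrightarrow> 0"
      by (intro tendsto_sandwich[OF _ _ tendsto_const e_lim]) (auto simp: near_def less_imp_le)
    then have "limitin mtopology (\<lambda>k. D (a (f x) k)) x sequentially"
      using x D by (simp add: limitin_metric_dist_null)
    then show "g (f x) = x"
      using g_lim[OF good] limitin_metric_unique trivial_limit_sequentially by blast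
  qed
  have f_meas: "f \<in> borel_measurable (metric_borel m)"
  proof -
    have [measurable]: "Measurable.pred (metric_borel m) (\<lambda>x. near x k i)" for k i
    proof -
      have "{x \<in> mspace m. near x k i} = mball (D i) (e k)" using D by (auto simp: near_def)
      moreover have "openin (mtopology_of m) (mball (D i) (e k))" by (simp add: mtopology_of_def)
      ultimately show ?thesis
        using sets_metric_borel_open by (simp add: pred_def)
    qed
    show ?thesis unfolding f_def quaternary_def by measurable
  qed
  have dist_g: "(\<lambda>r. mdist m y (g r)) \<in> borel_measurable borel" if y: "y \<in> mspace m" for y
  proof -
    define h where "h k r = (if good r then mdist m y (D (a r k)) else mdist m y (D 0))" for k r
    have "h k \<in> borel_measurable borel" for k
      unfolding h_def by measurable
    moreover have "(\<lambda>k. h k r) \<longlonglongrightarrow> mdist m y (g r)" for r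
    proof (cases "good r")
      case True
      have bound: "\<bar>mdist m y (D (a r k)) - mdist m y (g r)\<bar> \<le> mdist m (D (a r k)) (g r)" for k
        using triangle[OF y D[of "a r k"] g_space[of r]] triangle[OF y g_space[of r] D[of "a r k"]]
        by (simp add: commute abs_le_iff)
      have lim: "(\<lambda>k. mdist m (D (a r k)) (g r)) \<longlonglongrightarrow> 0"
        using g_lim[OF True] by (simp add: limitin_metric_dist_null)
      have "(\<lambda>k. mdist m y (D (a r k)) - mdist m y (g r)) \<longlonglongrightarrow> 0"
        by (rule Lim_null_comparison[OF _ lim]) (simp add: bound)
      then show ?thesis using True LIM_zero_cancel by (simp add: h_def)
    qed (simp add: h_def g_def)
    ultimately show ?thesis by (rule borel_measurable_LIMSEQ_real[rotated])
  qed
  have g_meas: "g \<in> borel \<rightarrow>\<^sub>M metric_borel m"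
  proof (rule measurable_metric_borelI)
    fix U assume U: "openin (mtopology_of m) U"
    define J where "J = {(i, k). mball (D i) (e k) \<subseteq> U}"
    have U_eq: "x \<in> U \<longleftrightarrow> (\<exists>(i, k)\<in>J. mdist m (D i) x < e k)" if x: "x \<in> mspace m" for x
    proof
      assume "x \<in> U"
      then obtain \<epsilon> where \<epsilon>: "\<epsilon> > 0" "mball x \<epsilon> \<subseteq> U"
        using U unfolding mtopology_of_def openin_mtopology by blast
      obtain k where k: "e k < \<epsilon> / 2"
        using order_tendstoD(2)[OF e_lim, of "\<epsilon> / 2"] \<epsilon> by (auto simp: eventually_sequentially)
      obtain i where i: "mdist m (D i) x < e k" using dense[OF x e0] by blast
      have "mball (D i) (e k) \<subseteq> mball x \<epsilon>"
      proof
        fix z assume z: "z \<in> mball (D i) (e k)"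
        then show "z \<in> mball x \<epsilon>"
          using triangle[OF x D[of i], of z] i k x by (auto simp: commute)
      qed
      with \<epsilon> i show "\<exists>(i, k)\<in>J. mdist m (D i) x < e k" by (auto simp: J_def)
    next
      assume "\<exists>(i, k)\<in>J. mdist m (D i) x < e k"
      then show "x \<in> U" using x D by (auto simp: J_def)
    qed
    have "g -` U \<inter> space borel = (\<Union>p\<in>J. {r. mdist m (D (fst p)) (g r) < e (snd p)})"
      using U_eq[OF g_space] by (auto simp: case_prod_beta)
    also have "\<dots> \<in> sets borel"
    proof (rule sets.countable_UN'')
      show "countable J" by simp
      show "{r. mdist m (D (fst p)) (g r) < e (snd p)} \<in> sets borel" for p
        using dist_g[OF D[of "fst p"]] by simp
    qed
    finally show "g -` U \<inter> space borel \<in> sets borel" .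
  qed (rule g_space)
  have f_range: "f x \<in> quaternary_cantor \<inter> {0<..<1}" if x: "x \<in> mspace m" for x
  proof -
    \<comment> \<open>Some ball of radius 1 is listed, so the code has a nonzero digit.\<close>
    obtain i where "near x 0 i" using dense[OF x e0[of 0]] by (auto simp: near_def)
    then have "0 < f x" unfolding f_def by (intro quaternary_pos[of _ "prod_encode (0, i)"]) simp
    moreover have "f x \<in> quaternary_cantor" "f x \<le> 1 / 3"
      unfolding f_def by (rule quaternary_in_cantor, rule quaternary_bounds(2))
    ultimately show ?thesis by simp
  qed
  show ?thesis using that[OF f_meas g_meas gf f_range] by blast
qed

section \<open>Copies of the line inside Borel sets\<close>

lemma separable_space_real: "separable_space (euclidean :: real topology)"
proof -
  obtain D :: "real set" where D: "countable D" "\<And>X. open X \<Longrightarrow> X \<noteq> {} \<Longrightarrow> \<exists>d\<in>D. d \<in> X"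
    using countable_dense_exists by blast
  have "closure D = UNIV"
    using D(2)[of "- closure D"] closure_subset[of D] by auto
  then show ?thesis using D(1) unfolding separable_space_def by auto
qed

text \<open>
  The coding of Polish spaces, applied to the line itself, gives a copy of the line that is Lebesgue null.
\<close>

lemma null_copy_of_real_line:
  obtains e e' :: "real \<Rightarrow> real"
  where "e \<in> borel_measurable borel" "e' \<in> borel_measurable borel"
    "\<And>r. e' (e r) = r" "\<And>r. e r \<in> quaternary_cantor \<inter> {0<..<1}"
proof -
  have sets_eq: "sets (metric_borel euclidean_metric) = sets (borel :: real measure)"
    by (simp add: metric_borel_def borel_def)
  have "mcomplete_of (euclidean_metric :: real metric)"
    unfolding euclidean_metric_def using complete_UNIV by (simp add: Met_TC.mcomplete_of)
  then have "polish_metric (euclidean_metric :: real metric)"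
    by (simp add: polish_metric_def separable_space_real)
  then obtain e e' :: "real \<Rightarrow> real"
    where "e \<in> borel_measurable (metric_borel euclidean_metric)" "e' \<in> borel \<rightarrow>\<^sub>M metric_borel euclidean_metric"
    and "\<And>r. e' (e r) = r" "\<And>r. e r \<in> quaternary_cantor \<inter> {0<..<1}"
    using polish_embeds_null[of "euclidean_metric :: real metric"] by auto
  then show ?thesis
    using that measurable_cong_sets[OF sets_eq refl] measurable_cong_sets[OF refl sets_eq] by blast
qed

lemma borel_retract_real_subset:
  fixes A :: "real set"
  assumes "A \<in> sets borel" "A \<noteq> {}"
  shows "borel_retract (restrict_space borel A) (borel :: real measure)"
proof -
  obtain a where a: "a \<in> A" using assms(2) by blast
  have "(\<lambda>r. if r \<in> A then r else a) \<in> borel \<rightarrow>\<^sub>M restrict_space borel A"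
    using a assms(1) by (intro measurable_restrict_space2) auto
  moreover have "(\<lambda>r. r) \<in> borel_measurable (restrict_space borel A)"
    by (intro measurable_restrict_space1) simp
  ultimately show ?thesis
    unfolding borel_retract_def by (auto intro!: exI[of _ "\<lambda>r. r"] exI[of _ "\<lambda>r. if r \<in> A then r else a"] simp: space_restrict_space)
qed

text \<open>
  An injection defined on \<open>(0, 1)\<close>, or even only on the null Cantor set, already carries a copy of the line,
  because that set contains one.
\<close>

lemma real_line_retract_of_subset:
  fixes s F :: "real \<Rightarrow> real"
  assumes s[measurable]: "s \<in> borel_measurable borel" and F[measurable]: "F \<in> borel_measurable borel"
    and "\<And>y. y \<in> quaternary_cantor \<inter> {0<..<1} \<Longrightarrow> F (s y) = y \<and> s y \<in> A"
  shows "borel_retract (borel :: real measure) (restrict_space borel A)"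
proof -
  obtain e e' :: "real \<Rightarrow> real" where [measurable]: "e \<in> borel_measurable borel" "e' \<in> borel_measurable borel"
    and e: "\<And>r. e' (e r) = r" "\<And>r. e r \<in> quaternary_cantor \<inter> {0<..<1}"
    using null_copy_of_real_line by blast
  have "(\<lambda>r. s (e r)) \<in> borel \<rightarrow>\<^sub>M restrict_space borel A"
    using assms(3) e(2) by (intro measurable_restrict_space2) auto
  moreover have "(\<lambda>r. e' (F r)) \<in> borel_measurable (restrict_space borel A)"
    by (intro measurable_restrict_space1) measurable
  ultimately show ?thesis
    unfolding borel_retract_def
    by (intro exI[of _ "\<lambda>r. s (e r)"] exI[of _ "\<lambda>r. e' (F r)"]) (use assms(3)[OF e(2)] e(1) in auto)
qed

text \<open>
  The quantile function \<open>s\<close> is the generalised inverse of the distribution function \<open>F\<close>.  As \<open>P\<close> has no atoms,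
  \<open>F\<close> is continuous and hence \<open>F (s y) = y\<close>.  The values of \<open>s\<close> are points at which \<open>F\<close> increases from the
  left; since \<open>F\<close> is constant on the intervals that miss a closed set carrying \<open>P\<close>, these values belong to that closed set.
\<close>

lemma diffused_quantile:
  fixes P :: "real measure"
  assumes "real_distribution P" and diff: "\<And>x. emeasure P {x} = 0"
  obtains s F :: "real \<Rightarrow> real"
  where "s \<in> borel_measurable borel" "F \<in> borel_measurable borel"
    "\<And>y. y \<in> {0<..<1} \<Longrightarrow> F (s y) = y"
    "distr (restrict_space lborel {0<..<1}) borel s = P"
    "\<And>Z y. closed Z \<Longrightarrow> emeasure P (- Z) = 0 \<Longrightarrow> y \<in> {0<..<1} \<Longrightarrow> s y \<in> Z"
proof -
  interpret cdf_distribution P using assms(1) by (simp add: cdf_distribution_def)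
  define s where "s y = (if y \<in> {0<..<1} then I y else 0)" for y :: real
  have pseudo: "y \<le> C x \<longleftrightarrow> s y \<le> x" if "y \<in> {0<..<1}" for x y
    using pseudoinverse[of y x] that by (simp add: s_def)
  have s_meas: "s \<in> borel_measurable borel"
    unfolding s_def using measurable_CI
    by (subst measurable_restrict_space_iff[symmetric]) auto
  have Cs: "C (s y) = y" if y: "y \<in> {0<..<1}" for y
  proof (rule antisym)
    show "y \<le> C (s y)" using pseudo[OF y] by simp
    show "C (s y) \<le> y"
    proof (rule ccontr)
      assume "\<not> C (s y) \<le> y"
      moreover have "isCont C (s y)" using diff by (simp add: isCont_cdf measure_def)
      then have "(C \<longlongrightarrow> C (s y)) (at_left (s y))"
        by (simp add: isCont_def filterlim_at_split)
      ultimately have "eventually (\<lambda>x. y < C x) (at_left (s y))"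
        by (intro order_tendstoD(1)) auto
      then have "eventually (\<lambda>x. y < C x \<and> x < s y) (at_left (s y))"
        by (intro eventually_conj) (auto simp: eventually_at_filter)
      then obtain x where "y < C x" "x < s y"
        using eventually_happens'[OF trivial_limit_at_left_real] by blast
      then show False using pseudo[OF y, of x] by simp
    qed
  qed
  have s_distr: "distr (restrict_space lborel {0<..<1}) borel s = P"
  proof -
    have "distr (restrict_space lborel {0<..<1}) borel s = distr (restrict_space lborel {0<..<1}) borel I"
      by (rule distr_cong) (auto simp: s_def space_restrict_space)
    then show ?thesis using distr_I_eq_M by simp
  qed
  have s_closed: "s y \<in> Z" if Z: "closed Z" "emeasure P (- Z) = 0" and y: "y \<in> {0<..<1}" for Z y
  proof (rule ccontr)
    assume "s y \<notin> Z"
    then obtain \<epsilon> where \<epsilon>: "\<epsilon> > 0" "ball (s y) \<epsilon> \<subseteq> - Z"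
      using Z(1) by (metis ComplI open_Compl open_contains_ball)
    define x where "x = s y - \<epsilon> / 2"
    have "{x<..s y} \<subseteq> - Z"
      using \<epsilon> unfolding x_def by (auto simp: subset_eq dist_real_def)
    then have "emeasure P {x<..s y} \<le> emeasure P (- Z)"
      using Z(1) by (intro emeasure_mono) auto
    then have "measure P {x<..s y} = 0" using Z(2) by (simp add: measure_def)
    then have "C (s y) = C x"
      using cdf_diff_eq[of x "s y"] \<epsilon>(1) by (simp add: x_def)
    then have "s y \<le> x" using pseudo[OF y, of x] Cs[OF y] by (metis order_refl)
    then show False using \<epsilon>(1) by (simp add: x_def)
  qed
  show ?thesis using that[OF s_meas measurable_C Cs s_distr s_closed] by blast
qed

text \<open>
  This replaces the perfect set theorem.  Inner regularity provides a compact \<open>K\<close> of positive measure in \<open>A\<close>, and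
  the quantile function of \<open>P\<close> conditioned on \<open>K\<close> takes its values in \<open>K\<close>.
\<close>

lemma real_line_retract_of_positive:
  fixes P :: "real measure"
  assumes "real_distribution P" "\<And>x. emeasure P {x} = 0" "A \<in> sets borel" "emeasure P A \<noteq> 0"
  shows "borel_retract (borel :: real measure) (restrict_space borel A)"
proof -
  interpret real_distribution P by fact
  have "emeasure P A = (SUP K\<in>{K. K \<subseteq> A \<and> compact K}. emeasure P K)"
    using assms(3) by (intro inner_regular) (auto simp: emeasure_eq_measure)
  with assms(4) have "\<not> (SUP K\<in>{K. K \<subseteq> A \<and> compact K}. emeasure P K) \<le> 0" by simp
  then obtain K where K: "K \<subseteq> A" "compact K" "emeasure P K \<noteq> 0"
    unfolding SUP_le_iff by auto
  have [simp]: "K \<in> sets P" "closed K" using K(2) by (auto intro: borel_compact compact_imp_closed)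
  let ?Q = "uniform_measure P K"
  have "prob_space ?Q" using K(3) by (intro prob_space_uniform_measure) (auto simp: emeasure_eq_measure)
  then have "real_distribution ?Q" by (simp add: real_distribution_def real_distribution_axioms_def)
  moreover have "emeasure ?Q {x} = 0" for x
    using assms(2)[of x] emeasure_eq_0[of "{x}" P "K \<inter> {x}"]
    by (subst emeasure_uniform_measure) auto
  moreover have "emeasure ?Q (- K) = 0" by (subst emeasure_uniform_measure) auto
  ultimately obtain s F :: "real \<Rightarrow> real" where "s \<in> borel_measurable borel" "F \<in> borel_measurable borel"
    "\<And>y. y \<in> {0<..<1} \<Longrightarrow> F (s y) = y" "\<And>y. y \<in> {0<..<1} \<Longrightarrow> s y \<in> K"
    using \<open>closed K\<close> diffused_quantile[of ?Q] by metis
  then show ?thesis using K(1) by (intro real_line_retract_of_subset[of s F]) auto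
qed

text \<open>
  The existence of a diffused probability is what makes \<open>M\<close> large enough: its image under an embedding \<open>f\<close> lives on
  the Borel set \<open>A\<close> onto which \<open>f\<close> maps, so \<open>A\<close>, and with it \<open>M\<close>, contains a copy of the line.
\<close>

theorem isomorphic_real_line:
  assumes "borel_retract M (borel :: real measure)"
    and P: "prob_space P" "sets P = sets M" "diffused P"
  shows "borel_isomorphic M (borel :: real measure)"
proof -
  obtain f :: "'a \<Rightarrow> real" and g
    where f[measurable]: "f \<in> borel_measurable M" and g[measurable]: "g \<in> borel \<rightarrow>\<^sub>M M"
      and gf: "\<And>x. x \<in> space M \<Longrightarrow> g (f x) = x"
    using assms(1) unfolding borel_retract_def by blast
  interpret P: prob_space P by fact
  have spP: "space P = space M" by (rule sets_eq_imp_space_eq[OF P(2)])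
  have fP[measurable]: "f \<in> borel_measurable P" using f measurable_cong_sets[OF P(2) refl] by blast
  define A where "A = {r. f (g r) = r}"
  have A: "A \<in> sets borel" unfolding A_def by measurable
  let ?Q = "distr P borel f"
  have "real_distribution ?Q" by simp
  moreover have "emeasure ?Q {r} = 0" for r
  proof -
    have "f -` {r} \<inter> space P \<subseteq> {g r}" using gf spP by auto
    moreover have "emeasure P {g r} = 0"
      using P(3) measurable_space[OF g] spP by (auto simp: diffused_def)
    moreover have "{g r} \<in> sets P"
    proof -
      have "{g r} = {x \<in> space M. f x = f (g r)}"
        using measurable_space[OF g, of r] gf by auto (metis gf)
      then show ?thesis using P(2) by simp
    qed
    ultimately show ?thesis
      by (simp add: emeasure_distr) (metis emeasure_eq_0)
  qed
  moreover have "emeasure ?Q A \<noteq> 0"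
  proof -
    have "f -` A \<inter> space P = space P" using gf spP by (auto simp: A_def)
    then show ?thesis using A by (simp add: emeasure_distr P.emeasure_space_1)
  qed
  ultimately have "borel_retract (borel :: real measure) (restrict_space borel A)"
    using A by (intro real_line_retract_of_positive) auto
  moreover have "borel_retract (restrict_space borel A) M"
  proof -
    have "g \<in> restrict_space borel A \<rightarrow>\<^sub>M M" by (intro measurable_restrict_space1 g)
    moreover have "f \<in> M \<rightarrow>\<^sub>M restrict_space borel A"
      using gf by (intro measurable_restrict_space2 f) (auto simp: A_def)
    ultimately show ?thesis
      unfolding borel_retract_def by (auto simp: space_restrict_space A_def intro!: exI[of _ g] exI[of _ f])
  qed
  ultimately show ?thesis
    using assms(1) borel_schroeder_bernstein borel_retract_trans by blast
qed

section \<open>All diffused probabilities are isomorphic\<close>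

text \<open>
  The uniform distribution on \<open>(0, 1)\<close>, regarded as a measure on the whole line so that isomorphisms can be
  total bijections of the line.
\<close>

definition uniform01 :: "real measure" where
  "uniform01 = distr (restrict_space lborel {0<..<1}) borel (\<lambda>x. x)"

text \<open>
  The distribution function \<open>F\<close> is used on \<open>T\<close>, the image under the quantile function of \<open>(0, 1)\<close> without the null
  Cantor set.  The complements of \<open>T\<close> and of its image \<open>B\<close> each contain a copy of the line, because the Cantor set is missing
  from \<open>B\<close> and its image under the quantile function from \<open>T\<close>; so both are isomorphic to the line.  They are null, so the way in which they are matched does not affect the
  image measure.
\<close>

lemma isomorphic_uniform_real:
  fixes P :: "real measure"
  assumes "real_distribution P" "\<And>x. emeasure P {x} = 0"
  obtains \<theta> \<eta> :: "real \<Rightarrow> real"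
  where "\<theta> \<in> borel_measurable borel" "\<eta> \<in> borel_measurable borel"
    "\<And>x. \<eta> (\<theta> x) = x" "\<And>y. \<theta> (\<eta> y) = y" "distr P borel \<theta> = uniform01"
proof -
  obtain s F :: "real \<Rightarrow> real"
    where s[measurable]: "s \<in> borel_measurable borel" and F[measurable]: "F \<in> borel_measurable borel"
      and Fs: "\<And>y. y \<in> {0<..<1} \<Longrightarrow> F (s y) = y"
      and s_distr: "distr (restrict_space lborel {0<..<1}) borel s = P"
    using diffused_quantile[OF assms] by metis
  have K[measurable]: "quaternary_cantor \<in> sets borel"
    using null_quaternary_cantor by (auto simp: null_sets_def)
  define B :: "real set" where "B = {0<..<1} - quaternary_cantor"
  define T where "T = {x. F x \<in> B \<and> s (F x) = x}"
  have B[measurable]: "B \<in> sets borel" unfolding B_def by measurable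
  have T[measurable]: "T \<in> sets borel" unfolding T_def by measurable
  have big: "borel_isomorphic (restrict_space borel (- A)) (borel :: real measure)"
    if A: "A \<in> sets borel" and *: "borel_retract (borel :: real measure) (restrict_space borel (- A))" for A :: "real set"
  proof (rule borel_schroeder_bernstein[OF borel_retract_real_subset *])
    show "- A \<in> sets borel" using A by simp
    obtain f where "f \<in> (borel :: real measure) \<rightarrow>\<^sub>M restrict_space borel (- A)"
      using * unfolding borel_retract_def by blast
    then have "f 0 \<in> - A" by (auto dest!: measurable_space simp: space_restrict_space)
    then show "- A \<noteq> {}" by blast
  qed
  have "borel_isomorphic (restrict_space borel (- T)) (borel :: real measure)"
    by (intro big T real_line_retract_of_subset[OF s F]) (auto simp: T_def B_def Fs)
  then obtain h k where h: "h \<in> borel_measurable (restrict_space borel (- T))"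
    and k: "k \<in> (borel :: real measure) \<rightarrow>\<^sub>M restrict_space borel (- T)"
    and kh: "\<And>x. x \<notin> T \<Longrightarrow> k (h x) = x" and hk: "\<And>y::real. h (k y) = y"
    unfolding borel_isomorphic_def by (auto simp: space_restrict_space)
  have "borel_isomorphic (restrict_space borel (- B)) (borel :: real measure)"
    by (intro big B real_line_retract_of_subset[of "\<lambda>x. x" "\<lambda>x. x"]) (auto simp: B_def)
  then obtain h' k' where h': "h' \<in> borel_measurable (restrict_space borel (- B))"
    and k': "k' \<in> (borel :: real measure) \<rightarrow>\<^sub>M restrict_space borel (- B)"
    and kh': "\<And>x. x \<notin> B \<Longrightarrow> k' (h' x) = x" and hk': "\<And>y::real. h' (k' y) = y"
    unfolding borel_isomorphic_def by (auto simp: space_restrict_space)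
  have kT: "k y \<notin> T" and kB: "k' y \<notin> B" for y
    using measurable_space[OF k, of y] measurable_space[OF k', of y] by (auto simp: space_restrict_space)
  have k1[measurable]: "k \<in> borel_measurable borel" "k' \<in> borel_measurable borel"
    using k k' by (auto simp: measurable_restrict_space2_iff)
  define \<theta> where "\<theta> x = (if x \<in> T then F x else k' (h x))" for x
  define \<eta> where "\<eta> y = (if y \<in> B then s y else k (h' y))" for y
  have \<theta>: "\<theta> \<in> borel_measurable borel"
    unfolding \<theta>_def
    by (subst measurable_If_restrict_space_iff)
       (use h T in \<open>auto intro!: measurable_restrict_space1 simp flip: Compl_eq intro: measurable_compose[OF _ k1(2)]\<close>)
  have \<eta>: "\<eta> \<in> borel_measurable borel"
    unfolding \<eta>_def
    by (subst measurable_If_restrict_space_iff)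
       (use h' B in \<open>auto intro!: measurable_restrict_space1 simp flip: Compl_eq intro: measurable_compose[OF _ k1(1)]\<close>)
  have "\<eta> (\<theta> x) = x" for x
    by (auto simp: \<theta>_def \<eta>_def T_def[THEN eqset_imp_iff] kB kh hk')
  moreover have \<theta>\<eta>: "\<theta> (\<eta> y) = y" for y
  proof (cases "y \<in> B")
    case True
    then have "F (s y) = y" by (intro Fs) (simp add: B_def)
    then have "s y \<in> T" using True by (simp add: T_def)
    then show ?thesis using True \<open>F (s y) = y\<close> by (simp add: \<theta>_def \<eta>_def)
  qed (simp add: \<theta>_def \<eta>_def kT hk kh')
  moreover have "distr P borel \<theta> = uniform01"
  proof -
    have \<theta>s: "\<theta> \<circ> s \<in> borel_measurable (restrict_space lborel {0<..<1})"
      using measurable_comp[OF s \<theta>] by (intro measurable_restrict_space1) simp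
    have "distr P borel \<theta> = distr (restrict_space lborel {0<..<1}) borel (\<theta> \<circ> s)"
      unfolding s_distr[symmetric] by (rule distr_distr) (auto intro: \<theta> measurable_restrict_space1)
    also have "\<dots> = uniform01"
      unfolding uniform01_def
    proof (rule distr_cong_AE)
      have "AE y in lborel. y \<notin> quaternary_cantor" by (rule AE_not_in[OF null_quaternary_cantor])
      then have "AE y in lborel. y \<in> {0<..<1} \<longrightarrow> (\<theta> \<circ> s) y = y"
      proof eventually_elim
        case (elim y)
        show ?case using \<theta>\<eta>[of y] elim by (auto simp: \<eta>_def B_def)
      qed
      then show "AE y in restrict_space lborel {0<..<1}. (\<theta> \<circ> s) y = y"
        by (subst AE_restrict_space_iff) auto
    qed (auto intro: \<theta>s measurable_restrict_space1)
    finally show ?thesis .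
  qed
  ultimately show ?thesis using that \<theta> \<eta> by blast
qed

theorem isomorphic_uniform:
  fixes M P :: "'a measure"
  assumes "borel_retract M (borel :: real measure)"
    and P: "prob_space P" "sets P = sets M" "diffused P"
  obtains f :: "'a \<Rightarrow> real" and g
  where "f \<in> borel_measurable M" "g \<in> borel \<rightarrow>\<^sub>M M"
    "\<And>x. x \<in> space M \<Longrightarrow> g (f x) = x" "\<And>y. f (g y) = y" "distr P borel f = uniform01"
proof -
  obtain f :: "'a \<Rightarrow> real" and g
    where f[measurable]: "f \<in> borel_measurable M" and g[measurable]: "g \<in> borel \<rightarrow>\<^sub>M M"
      and gf: "\<And>x. x \<in> space M \<Longrightarrow> g (f x) = x" and fg: "\<And>y. f (g y) = y"
    using isomorphic_real_line[OF assms] unfolding borel_isomorphic_def space_borel by (blast intro: UNIV_I)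
  interpret P: prob_space P by fact
  have spP: "space P = space M" by (rule sets_eq_imp_space_eq[OF P(2)])
  have fP[measurable]: "f \<in> borel_measurable P" using f measurable_cong_sets[OF P(2) refl] by blast
  have "real_distribution (distr P borel f)" by simp
  moreover have "emeasure (distr P borel f) {r} = 0" for r
  proof -
    have "f -` {r} \<inter> space P = {g r}" using gf fg spP measurable_space[OF g] by auto
    then show ?thesis
      using P(3) measurable_space[OF g] spP by (auto simp: diffused_def emeasure_distr)
  qed
  ultimately obtain \<theta> \<eta> :: "real \<Rightarrow> real"
    where \<theta>: "\<theta> \<in> borel_measurable borel" and \<eta>: "\<eta> \<in> borel_measurable borel"
      and inv: "\<And>x. \<eta> (\<theta> x) = x" "\<And>y. \<theta> (\<eta> y) = y"
      and d: "distr (distr P borel f) borel \<theta> = uniform01"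
    using isomorphic_uniform_real by metis
  show ?thesis
  proof (rule that[of "\<theta> \<circ> f" "g \<circ> \<eta>"])
    show "distr P borel (\<theta> \<circ> f) = uniform01" using d distr_distr[OF \<theta> fP] by simp
    show "\<theta> \<circ> f \<in> borel_measurable M" by (rule measurable_comp[OF f \<theta>])
    show "g \<circ> \<eta> \<in> borel \<rightarrow>\<^sub>M M" by (rule measurable_comp[OF \<eta> g])
  qed (simp_all add: gf fg inv)
qed

section \<open>Isomorphism with Lebesgue measure up to equivalence\<close>

text \<open>
  The probability has a density with respect to \<open>M\<close> that is integrable and strictly positive; positivity keeps the
  null sets unchanged.
\<close>

lemma (in sigma_finite_measure) equivalent_prob_space:
  assumes "emeasure M (space M) \<noteq> 0"
  obtains P where "prob_space P" "sets P = sets M" "null_sets P = null_sets M"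
proof -
  obtain h where [measurable]: "h \<in> borel_measurable M" and fin: "integral\<^sup>N M h \<noteq> \<infinity>"
    and pos: "\<And>x. x \<in> space M \<Longrightarrow> 0 < h x"
    using Ex_finite_integrable_function by blast
  define c where "c = integral\<^sup>N M h"
  have c: "c \<noteq> 0"
  proof
    assume "c = 0"
    then have "AE x in M. h x = 0" by (simp add: c_def nn_integral_0_iff_AE)
    then have "AE x in M. False" using AE_space by eventually_elim (use pos in fastforce)
    then show False using assms by (simp add: AE_iff_null_sets null_sets_def trivial_limit_def[symmetric] ae_filter_eq_bot_iff)
  qed
  define P where "P = density M (\<lambda>x. h x / c)"
  have "emeasure P (space P) = (\<integral>\<^sup>+x. h x / c \<partial>M)"
    unfolding P_def by (subst emeasure_density) (auto intro!: nn_integral_cong)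
  also have "\<dots> = c / c" by (simp add: nn_integral_divide c_def)
  also have "\<dots> = 1" using c fin by (intro ennreal_divide_self) (auto simp: c_def top.not_eq_extremum)
  finally have "prob_space P" by (rule prob_spaceI)
  moreover have "sets P = sets M" by (simp add: P_def)
  moreover have "null_sets P = null_sets M"
  proof -
    have nz: "h x / c \<noteq> 0" if "x \<in> space M" for x
      using pos[OF that] fin by (auto simp: c_def ennreal_divide_eq_0_iff)
    have "A \<in> null_sets P \<longleftrightarrow> A \<in> null_sets M" for A
    proof -
      have "(AE x in M. x \<in> A \<longrightarrow> h x / c = 0) \<longleftrightarrow> (AE x in M. x \<notin> A)"
        by (rule AE_cong) (use nz in blast)
      moreover have "A \<in> null_sets P \<longleftrightarrow> A \<in> sets M \<and> (AE x in M. x \<in> A \<longrightarrow> h x / c = 0)"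
        unfolding P_def by (rule null_sets_density_iff) measurable
      ultimately show ?thesis by (metis AE_iff_null_sets null_setsD2)
    qed
    then show ?thesis by blast
  qed
  ultimately show ?thesis using that by blast
qed

text \<open>
  A probability equivalent to \<open>\<mu>\<close> and one equivalent to Lebesgue measure are both isomorphic to the uniform
  distribution, hence to each other; and null sets depend only on the equivalence class.
\<close>

theorem isomorphic_lebesgue:
  fixes \<mu> :: "'a measure"
  assumes retract: "borel_retract \<mu> (borel :: real measure)"
    and "sigma_finite_measure \<mu>" "diffused \<mu>" "emeasure \<mu> (space \<mu>) \<noteq> 0"
    and singletons: "\<And>x. x \<in> space \<mu> \<Longrightarrow> {x} \<in> sets \<mu>"
  obtains f :: "'a \<Rightarrow> real" and g
  where "f \<in> borel_measurable \<mu>" "g \<in> borel \<rightarrow>\<^sub>M \<mu>"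
    "\<And>x. x \<in> space \<mu> \<Longrightarrow> g (f x) = x" "\<And>y. f (g y) = y"
    "null_sets (distr lborel \<mu> g) = null_sets \<mu>"
proof -
  interpret sigma_finite_measure \<mu> by fact
  obtain P where P: "prob_space P" "sets P = sets \<mu>" "null_sets P = null_sets \<mu>"
    using equivalent_prob_space assms(4) by blast
  have spP: "space P = space \<mu>" by (rule sets_eq_imp_space_eq[OF P(2)])
  have "diffused P"
    using assms(3) singletons P unfolding diffused_def spP null_sets_def by blast
  then obtain f1 :: "'a \<Rightarrow> real" and g1 where 1: "f1 \<in> borel_measurable \<mu>" "g1 \<in> borel \<rightarrow>\<^sub>M \<mu>"
    "\<And>x. x \<in> space \<mu> \<Longrightarrow> g1 (f1 x) = x" "\<And>y. f1 (g1 y) = y" "distr P borel f1 = uniform01"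
    using isomorphic_uniform[OF retract P(1,2)] by metis
  obtain Q :: "real measure" where Q: "prob_space Q" "sets Q = sets lborel" "null_sets Q = null_sets lborel"
    using lborel.equivalent_prob_space by auto
  have "{x} \<in> null_sets Q" for x unfolding Q(3) by (rule countable_imp_null_set_lborel) simp
  then have "diffused Q" by (auto simp: diffused_def)
  moreover have "borel_retract (borel :: real measure) (borel :: real measure)"
    unfolding borel_retract_def by (intro exI[of _ "\<lambda>x. x"]) simp
  ultimately obtain f2 g2 :: "real \<Rightarrow> real" where 2: "f2 \<in> borel_measurable borel" "g2 \<in> borel_measurable borel"
    "\<And>x. g2 (f2 x) = x" "\<And>y. f2 (g2 y) = y" "distr Q borel f2 = uniform01"
    using isomorphic_uniform[of "borel :: real measure" Q] Q(1,2) by (metis UNIV_I sets_lborel space_borel)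
  have meas: "borel_measurable P = borel_measurable \<mu>" "borel_measurable Q = borel_measurable borel"
    using measurable_cong_sets[OF P(2) refl] measurable_cong_sets[OF Q(2) refl] by auto
  define f where "f = g2 \<circ> f1"
  define g where "g = g1 \<circ> f2"
  have f: "f \<in> borel_measurable \<mu>" unfolding f_def by (rule measurable_comp[OF 1(1) 2(2)])
  have g: "g \<in> borel \<rightarrow>\<^sub>M \<mu>" unfolding g_def by (rule measurable_comp[OF 2(1) 1(2)])
  have gf: "g (f x) = x" if "x \<in> space \<mu>" for x using that by (simp add: f_def g_def 1 2)
  have fg: "f (g y) = y" for y by (simp add: f_def g_def 1 2)
  have "distr P borel f = distr (distr Q borel f2) borel g2"
    unfolding 2(5) 1(5)[symmetric] f_def using 1(1) 2(2) meas by (subst distr_distr) auto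
  also have "\<dots> = distr Q borel (\<lambda>x. x)"
    using 2(1,2) meas by (subst distr_distr) (auto simp: comp_def 2)
  also have "\<dots> = Q" using Q(2) by (intro distr_id2) simp
  finally have PQ: "distr P borel f = Q" .
  have "N \<in> null_sets (distr lborel \<mu> g) \<longleftrightarrow> N \<in> null_sets \<mu>" if N: "N \<in> sets \<mu>" for N
  proof -
    have gN: "g -` N \<in> sets borel" by (rule measurable_sets_borel[OF g N])
    have "N \<in> null_sets (distr lborel \<mu> g) \<longleftrightarrow> g -` N \<in> null_sets lborel"
      using g N by (subst null_sets_distr_iff) auto
    also have "\<dots> \<longleftrightarrow> g -` N \<in> null_sets (distr P borel f)" by (simp add: PQ Q(3))
    also have "\<dots> \<longleftrightarrow> f -` (g -` N) \<inter> space P \<in> null_sets P"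
      using f gN meas by (subst null_sets_distr_iff) auto
    also have "f -` (g -` N) \<inter> space P = N"
      using gf sets.sets_into_space[OF N] spP by auto
    finally show ?thesis by (simp add: P(3))
  qed
  then have "null_sets (distr lborel \<mu> g) = null_sets \<mu>"
    by (metis null_setsD2 sets_distr subset_antisym subsetI)
  then show ?thesis using that[OF f g gf fg] by blast
qed

section \<open>Regularity of Lebesgue measure\<close>

lemma lborel_outer_INF:
  fixes E :: "'a::euclidean_space set"
  assumes E: "E \<in> sets borel"
  shows "emeasure lborel E = (INF U\<in>{U. E \<subseteq> U \<and> open U}. emeasure lborel U)"
proof (rule antisym)
  show "emeasure lborel E \<le> (INF U\<in>{U. E \<subseteq> U \<and> open U}. emeasure lborel U)"
    by (auto intro!: INF_greatest emeasure_mono)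
  show "(INF U\<in>{U. E \<subseteq> U \<and> open U}. emeasure lborel U) \<le> emeasure lborel E"
  proof (rule ennreal_le_epsilon)
    fix e :: real assume "0 < e"
    then obtain U where U: "open U" "E \<subseteq> U" "emeasure lborel (U - E) \<le> e"
      using outer_regular_lborel_le[OF E] by blast
    have "(INF U\<in>{U. E \<subseteq> U \<and> open U}. emeasure lborel U) \<le> emeasure lborel (E \<union> (U - E))"
      using U by (intro INF_lower2[of U]) (auto simp: Un_absorb1)
    also have "\<dots> \<le> emeasure lborel E + emeasure lborel (U - E)"
      using U E by (intro emeasure_subadditive) auto
    also have "\<dots> \<le> emeasure lborel E + ennreal e" using U(3) by (rule add_left_mono)
    finally show "(INF U\<in>{U. E \<subseteq> U \<and> open U}. emeasure lborel U) \<le> emeasure lborel E + ennreal e" .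
  qed
qed

text \<open>
  Inner regularity holds for finite measures on complete spaces, thus for the restrictions of Lebesgue measure to
  the balls around the origin, whose suprema recover Lebesgue measure.
\<close>

lemma lborel_inner_SUP:
  fixes E :: "'a::euclidean_space set"
  assumes E: "E \<in> sets borel"
  shows "emeasure lborel E = (SUP K\<in>{K. K \<subseteq> E \<and> compact K}. emeasure lborel K)" (is "_ = ?S")
proof (rule antisym)
  show "?S \<le> emeasure lborel E"
    by (rule SUP_least) (use E in \<open>auto intro: emeasure_mono\<close>)
  have "emeasure lborel (E \<inter> cball 0 (real n)) \<le> ?S" for n
  proof -
    let ?B = "cball 0 (real n) :: 'a set"
    let ?D = "density lborel (indicator ?B)"
    have [measurable]: "?B \<in> sets borel" by simp
    have D: "emeasure ?D A = emeasure lborel (A \<inter> ?B)" if "A \<in> sets borel" for A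
      using that by (subst emeasure_density) (auto simp: indicator_inter_arith[symmetric] ac_simps)
    have "emeasure ?D E = (SUP K\<in>{K. K \<subseteq> E \<and> compact K}. emeasure ?D K)"
      using E by (intro inner_regular) (use emeasure_compact_finite[of ?B] in \<open>auto simp: D less_top[symmetric]\<close>)
    also have "\<dots> \<le> ?S"
    proof (rule SUP_mono)
      fix K assume "K \<in> {K. K \<subseteq> E \<and> compact K}"
      then show "\<exists>K'\<in>{K. K \<subseteq> E \<and> compact K}. emeasure ?D K \<le> emeasure lborel K'"
        by (intro bexI[of _ K]) (auto simp: D borel_compact intro!: emeasure_mono)
    qed
    finally show ?thesis using D[OF E] by simp
  qed
  moreover have "(SUP n. emeasure lborel (E \<inter> cball 0 (real n))) = emeasure lborel (\<Union>n. E \<inter> cball 0 (real n))"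
    using E by (intro SUP_emeasure_incseq) (auto simp: incseq_def)
  moreover have "(\<Union>n. E \<inter> cball 0 (real n)) = E" using real_arch_simple by auto
  ultimately show "emeasure lborel E \<le> ?S" by (metis (no_types, lifting) SUP_least)
qed

section \<open>Transporting the group of reals\<close>

text \<open>
  A Borel bijection with the line, with no relation to the metric \<open>\<rho>\<close> beyond measurability.  The structure of the line
  is copied along it; then \<open>g\<close> is an isometry of the line onto the new metric space, an isomorphism from the additive group
  of reals, and an isomorphism of measure spaces.  All properties are read off on the preimages under \<open>g\<close>.
\<close>

locale line_transport =
  fixes \<rho> :: "'a metric" and f :: "'a \<Rightarrow> real" and g :: "real \<Rightarrow> 'a"
  assumes f: "f \<in> borel_measurable (metric_borel \<rho>)" and g: "g \<in> borel \<rightarrow>\<^sub>M metric_borel \<rho>"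
    and gf: "\<And>x. x \<in> mspace \<rho> \<Longrightarrow> g (f x) = x" and fg [simp]: "\<And>y. f (g y) = y"
begin

lemma g_in [simp]: "g y \<in> mspace \<rho>"
  using measurable_space[OF g] by simp

definition line_metric :: "'a metric" where
  "line_metric = metric (mspace \<rho>, \<lambda>x y. \<bar>f x - f y\<bar>)"

definition line_group :: "'a monoid" where
  "line_group = \<lparr>carrier = mspace \<rho>, mult = \<lambda>x y. g (f x + f y), one = g 0\<rparr>"

definition line_measure :: "'a measure" where
  "line_measure = distr lborel (metric_borel \<rho>) g"

sublocale T: Metric_space "mspace \<rho>" "\<lambda>x y. \<bar>f x - f y\<bar>"
proof
  show "\<bar>f x - f y\<bar> = 0 \<longleftrightarrow> x = y" if "x \<in> mspace \<rho>" "y \<in> mspace \<rho>" for x y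
    using gf[OF that(1)] gf[OF that(2)] by (metis abs_eq_0 right_minus_eq)
qed (simp_all add: abs_minus_commute)

lemma mspace_line_metric [simp]: "mspace line_metric = mspace \<rho>"
  and mdist_line_metric [simp]: "mdist line_metric = (\<lambda>x y. \<bar>f x - f y\<bar>)"
  by (simp_all add: line_metric_def)

lemma homeomorphic_maps_line: "homeomorphic_maps (euclidean :: real topology) (mtopology_of line_metric) g f"
proof -
  have "Lipschitz_continuous_map line_metric euclidean_metric f"
    unfolding Lipschitz_continuous_map_def by (auto simp: dist_real_def intro!: exI[of _ 1])
  moreover have "Lipschitz_continuous_map euclidean_metric line_metric g"
    unfolding Lipschitz_continuous_map_def by (auto simp: dist_real_def intro!: exI[of _ 1])
  ultimately show ?thesis
    unfolding homeomorphic_maps_def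
    by (auto dest!: Lipschitz_continuous_imp_continuous_map simp: gf)
qed

lemma homeomorphic_map_line: "homeomorphic_map (euclidean :: real topology) (mtopology_of line_metric) g"
  using homeomorphic_maps_line by (simp add: homeomorphic_maps_map)

lemma homeomorphic_space_line: "(euclidean :: real topology) homeomorphic_space mtopology_of line_metric"
  using homeomorphic_maps_line homeomorphic_space_def by blast

lemma continuous_f: "continuous_map (mtopology_of line_metric) euclidean f"
  and continuous_g: "continuous_map euclidean (mtopology_of line_metric) g"
  using homeomorphic_maps_line by (auto simp: homeomorphic_maps_def)

lemma image_vimage_g: "E \<subseteq> mspace \<rho> \<Longrightarrow> g ` (g -` E) = E"
proof (intro equalityI subsetI)
  fix x assume "E \<subseteq> mspace \<rho>" "x \<in> E"
  then have "x = g (f x)" "f x \<in> g -` E" using gf[of x] by auto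
  then show "x \<in> g ` (g -` E)" by blast
qed auto

lemma inj_g: "inj g"
  by (metis fg injI)

lemma sets_vimage_g: "E \<subseteq> mspace \<rho> \<Longrightarrow> E \<in> sets (metric_borel \<rho>) \<longleftrightarrow> g -` E \<in> sets borel"
proof
  assume "E \<in> sets (metric_borel \<rho>)"
  then show "g -` E \<in> sets borel" by (rule measurable_sets_borel[OF g])
next
  assume E: "E \<subseteq> mspace \<rho>" "g -` E \<in> sets borel"
  have "f -` (g -` E) \<inter> space (metric_borel \<rho>) = E" using E(1) gf by auto
  then show "E \<in> sets (metric_borel \<rho>)" using measurable_sets[OF f E(2)] by simp
qed

lemma openin_vimage_g: "U \<subseteq> mspace \<rho> \<Longrightarrow> openin (mtopology_of line_metric) U \<longleftrightarrow> open (g -` U)"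
  using homeomorphic_map_openness[OF homeomorphic_map_line, of "g -` U"] by (simp add: image_vimage_g del: image_vimage_eq)

lemma compactin_vimage_g: "K \<subseteq> mspace \<rho> \<Longrightarrow> compactin (mtopology_of line_metric) K \<longleftrightarrow> compact (g -` K)"
  using homeomorphic_map_compactness[OF homeomorphic_map_line, of "g -` K"] by (simp add: image_vimage_g del: image_vimage_eq)

text \<open>
  The bijection is a homeomorphism for the new metric and a Borel isomorphism for \<open>\<rho>\<close>, so a set is Borel for either
  metric if and only if its preimage under \<open>g\<close> is a Borel set of reals.
\<close>

lemma sets_line_metric: "sets (metric_borel line_metric) = sets (metric_borel \<rho>)"
proof
  have "U \<in> sets (metric_borel \<rho>)" if "openin (mtopology_of line_metric) U" for U
  proof -
    have "U \<subseteq> mspace \<rho>" using openin_subset[OF that] by simp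
    then show ?thesis using that by (simp add: sets_vimage_g openin_vimage_g)
  qed
  then have "sigma_sets (space (metric_borel \<rho>)) {U. openin (mtopology_of line_metric) U} \<subseteq> sets (metric_borel \<rho>)"
    by (intro sets.sigma_sets_subset) auto
  moreover have "sets (metric_borel line_metric) = sigma_sets (mspace \<rho>) {U. openin (mtopology_of line_metric) U}"
    unfolding metric_borel_def using openin_subset[of "mtopology_of line_metric"] by (subst sets_measure_of) auto
  ultimately show "sets (metric_borel line_metric) \<subseteq> sets (metric_borel \<rho>)" by simp
  have f': "f \<in> borel_measurable (metric_borel line_metric)"
  proof (rule borel_measurableI)
    fix S :: "real set" assume "open S"
    then have "openin (mtopology_of line_metric) {x \<in> mspace \<rho>. f x \<in> S}"
      using openin_continuous_map_preimage[OF continuous_f, of S] by simp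
    then show "f -` S \<inter> space (metric_borel line_metric) \<in> sets (metric_borel line_metric)"
      by (auto dest!: sets_metric_borel_open simp: vimage_def Int_def conj_commute)
  qed
  show "sets (metric_borel \<rho>) \<subseteq> sets (metric_borel line_metric)"
  proof
    fix E assume E: "E \<in> sets (metric_borel \<rho>)"
    then have "E \<subseteq> mspace \<rho>" using sets.sets_into_space by fastforce
    then have "f -` (g -` E) \<inter> space (metric_borel line_metric) = E" using gf by auto
    then show "E \<in> sets (metric_borel line_metric)"
      using measurable_sets[OF f' measurable_sets_borel[OF g E]] by simp
  qed
qed

lemma polish_line_metric: "polish_metric line_metric"
proof -
  have "T.mcomplete"
    unfolding T.mcomplete_def
  proof (intro allI impI)
    fix \<sigma> assume \<sigma>: "T.MCauchy \<sigma>"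
    then have "Cauchy (f \<circ> \<sigma>)" unfolding T.MCauchy_def Cauchy_def by (auto simp: dist_real_def)
    then obtain l where l: "(f \<circ> \<sigma>) \<longlonglongrightarrow> l" using Cauchy_convergent convergent_def by blast
    have "limitin T.mtopology \<sigma> (g l) sequentially"
      unfolding T.limitin_metric
    proof (intro conjI allI impI g_in)
      fix \<epsilon> :: real assume "0 < \<epsilon>"
      then have "eventually (\<lambda>n. dist ((f \<circ> \<sigma>) n) l < \<epsilon>) sequentially" using l by (simp add: tendsto_iff)
      then show "eventually (\<lambda>n. \<sigma> n \<in> mspace \<rho> \<and> \<bar>f (\<sigma> n) - f (g l)\<bar> < \<epsilon>) sequentially"
        by eventually_elim (use \<sigma> in \<open>auto simp: T.MCauchy_def dist_real_def\<close>)
    qed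
    then show "\<exists>x. limitin T.mtopology \<sigma> x sequentially" by blast
  qed
  then have "mcomplete_of line_metric" by (simp add: line_metric_def)
  moreover have "separable_space (mtopology_of line_metric)"
    using homeomorphic_separable_space[OF homeomorphic_space_line] separable_space_real by simp
  ultimately show ?thesis by (simp add: polish_metric_def)
qed

lemma carrier_line_group [simp]: "carrier line_group = mspace \<rho>"
  and mult_line_group [simp]: "x \<otimes>\<^bsub>line_group\<^esub> y = g (f x + f y)"
  and one_line_group [simp]: "\<one>\<^bsub>line_group\<^esub> = g 0"
  by (simp_all add: line_group_def)

lemma group_line_group: "group line_group"
proof (rule groupI)
  show "\<exists>y\<in>carrier line_group. y \<otimes>\<^bsub>line_group\<^esub> x = \<one>\<^bsub>line_group\<^esub>" if "x \<in> carrier line_group" for x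
    by (rule bexI[of _ "g (- f x)"]) simp_all
qed (simp_all add: gf add.assoc)

lemma inv_line_group: "x \<in> mspace \<rho> \<Longrightarrow> inv\<^bsub>line_group\<^esub> x = g (- f x)"
  by (rule group.inv_equality[OF group_line_group]) simp_all

lemma polish_line_group: "polish_group line_metric line_group"
proof -
  let ?T = "mtopology_of line_metric"
  have "continuous_map (prod_topology ?T ?T) euclideanreal (\<lambda>p. - f (fst p) + f (snd p))"
    by (intro continuous_intros continuous_map_compose[OF continuous_map_fst continuous_f, unfolded comp_def]
          continuous_map_compose[OF continuous_map_snd continuous_f, unfolded comp_def])
  then have "continuous_map (prod_topology ?T ?T) ?T (\<lambda>p. g (- f (fst p) + f (snd p)))"
    using continuous_map_compose[OF _ continuous_g] by (fastforce simp: comp_def)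
  then have "continuous_map (prod_topology ?T ?T) ?T (\<lambda>(x, y). inv\<^bsub>line_group\<^esub> x \<otimes>\<^bsub>line_group\<^esub> y)"
    by (rule continuous_map_eq) (auto simp: inv_line_group)
  then show ?thesis
    by (simp add: polish_group_def group_line_group polish_line_metric)
qed

lemma locally_compact_line: "locally_compact_space (mtopology_of line_metric)"
  using homeomorphic_locally_compact_space[OF homeomorphic_space_line] locally_compact_space_euclidean[where 'a = real] by simp

lemma not_compact_line: "\<not> compact_space (mtopology_of line_metric)"
  using homeomorphic_compact_space[OF homeomorphic_space_line] not_compact_UNIV[where 'a = real]
  by (simp add: compact_space_def)

lemma sets_line_measure [simp]: "sets line_measure = sets (metric_borel \<rho>)"
  and space_line_measure [simp]: "space line_measure = mspace \<rho>"
  by (simp_all add: line_measure_def)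

lemma emeasure_line_measure: "E \<in> sets (metric_borel \<rho>) \<Longrightarrow> emeasure line_measure E = emeasure lborel (g -` E)"
  unfolding line_measure_def using g by (subst emeasure_distr) auto

lemma diffused_line_measure: "diffused line_measure"
  unfolding diffused_def
proof
  fix x assume x: "x \<in> space line_measure"
  then have "g -` {x} = {f x}" using gf by auto
  then show "emeasure line_measure {x} = 0"
    using x by (subst emeasure_line_measure) (auto simp: sets_vimage_g)
qed

text \<open>
  In the coordinate \<open>f\<close> both cosets are the same translate, because addition of reals is commutative.
\<close>

lemma translate:
  assumes "E \<subseteq> mspace \<rho>" "a \<in> mspace \<rho>"
  shows "a <#\<^bsub>line_group\<^esub> E \<subseteq> mspace \<rho>" "E #>\<^bsub>line_group\<^esub> a \<subseteq> mspace \<rho>"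
    and "g -` (a <#\<^bsub>line_group\<^esub> E) = (+) (- f a) -` (g -` E)" "g -` (E #>\<^bsub>line_group\<^esub> a) = (+) (- f a) -` (g -` E)"
proof -
  have eq: "g r = g (f a + f x) \<longleftrightarrow> g (- f a + r) = x" if "x \<in> mspace \<rho>" for r x
  proof -
    have "g r = g (f a + f x) \<longleftrightarrow> r = f a + f x" using inj_g by (simp add: inj_eq)
    also have "\<dots> \<longleftrightarrow> - f a + r = f x" by auto
    also have "\<dots> \<longleftrightarrow> g (- f a + r) = x" using gf[OF that] by (metis fg)
    finally show ?thesis .
  qed
  show "a <#\<^bsub>line_group\<^esub> E \<subseteq> mspace \<rho>" "E #>\<^bsub>line_group\<^esub> a \<subseteq> mspace \<rho>"
    by (auto simp: l_coset_def r_coset_def)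
  show "g -` (a <#\<^bsub>line_group\<^esub> E) = (+) (- f a) -` (g -` E)"
    using eq assms(1) by (auto simp: l_coset_def subset_iff)
  show "g -` (E #>\<^bsub>line_group\<^esub> a) = (+) (- f a) -` (g -` E)"
    using eq assms(1) by (auto simp: r_coset_def subset_iff add.commute[of _ "f a"])
qed

lemma emeasure_translate:
  assumes "A \<in> sets borel"
  shows "(+) c -` A \<in> sets borel" "emeasure lborel ((+) c -` A) = emeasure lborel (A :: real set)"
proof -
  show "(+) c -` A \<in> sets borel" by (rule measurable_sets_borel[OF _ assms]) measurable
  have "emeasure lborel A = emeasure (distr lborel borel ((+) c)) A" by (simp add: lborel_distr_plus)
  then show "emeasure lborel ((+) c -` A) = emeasure lborel A"
    using assms by (simp add: emeasure_distr)
qed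

lemma invariant_one_side:
  assumes "E \<in> sets (metric_borel \<rho>)" "a \<in> mspace \<rho>"
  shows "a <#\<^bsub>line_group\<^esub> E \<in> sets (metric_borel \<rho>)" "E #>\<^bsub>line_group\<^esub> a \<in> sets (metric_borel \<rho>)"
    "emeasure line_measure (a <#\<^bsub>line_group\<^esub> E) = emeasure line_measure E"
    "emeasure line_measure (E #>\<^bsub>line_group\<^esub> a) = emeasure line_measure E"
proof -
  have E: "E \<subseteq> mspace \<rho>" using sets.sets_into_space[OF assms(1)] by simp
  note t = translate[OF E assms(2)] and m = emeasure_translate[OF measurable_sets_borel[OF g assms(1)]]
  show *: "a <#\<^bsub>line_group\<^esub> E \<in> sets (metric_borel \<rho>)" "E #>\<^bsub>line_group\<^esub> a \<in> sets (metric_borel \<rho>)"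
    using t m by (simp_all add: sets_vimage_g)
  show "emeasure line_measure (a <#\<^bsub>line_group\<^esub> E) = emeasure line_measure E"
    "emeasure line_measure (E #>\<^bsub>line_group\<^esub> a) = emeasure line_measure E"
    using t m * assms(1) by (simp_all add: emeasure_line_measure)
qed

lemma invariant_line_measure:
  "left_invariant line_group line_measure" "right_invariant line_group line_measure" "two_sided_invariant line_group line_measure"
  by (simp_all add: left_invariant_def right_invariant_def two_sided_invariant_def invariant_one_side)

lemma outer_regular_line_measure: "outer_regular line_metric line_measure"
  unfolding outer_regular_def
proof
  fix E assume E: "E \<in> sets line_measure"
  then have EX: "E \<subseteq> mspace \<rho>" using sets.sets_into_space by fastforce
  have "emeasure line_measure ` {U. E \<subseteq> U \<and> openin (mtopology_of line_metric) U}
      = emeasure lborel ` {V. g -` E \<subseteq> V \<and> open V}" (is "?L = ?R")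
  proof (intro equalityI subsetI)
    fix x assume "x \<in> ?L"
    then obtain U where U: "x = emeasure line_measure U" "E \<subseteq> U" "openin (mtopology_of line_metric) U" by blast
    have "U \<subseteq> mspace \<rho>" using openin_subset[OF U(3)] by simp
    then have "open (g -` U)" "x = emeasure lborel (g -` U)"
      using U by (simp_all add: openin_vimage_g sets_vimage_g emeasure_line_measure)
    then show "x \<in> ?R" using U(2) by blast
  next
    fix x assume "x \<in> ?R"
    then obtain V where V: "x = emeasure lborel V" "g -` E \<subseteq> V" "open V" by blast
    have "g -` g ` V = V" "g ` V \<subseteq> mspace \<rho>" using inj_g by (auto simp: inj_vimage_image_eq)
    moreover have "E \<subseteq> g ` V" using V(2) image_vimage_g[OF EX] by blast
    ultimately have "x = emeasure line_measure (g ` V)" "openin (mtopology_of line_metric) (g ` V)" "E \<subseteq> g ` V"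
      using V by (simp_all add: openin_vimage_g sets_vimage_g emeasure_line_measure)
    then show "x \<in> ?L" by blast
  qed
  moreover have "emeasure line_measure E = (INF V\<in>{V. g -` E \<subseteq> V \<and> open V}. emeasure lborel V)"
    using E EX by (subst lborel_outer_INF[symmetric]) (simp_all add: sets_vimage_g emeasure_line_measure)
  ultimately show "emeasure line_measure E = (INF U\<in>{U. E \<subseteq> U \<and> openin (mtopology_of line_metric) U}. emeasure line_measure U)"
    by simp
qed

lemma inner_regular_line_measure: "inner_regular line_metric line_measure"
  unfolding inner_regular_def
proof
  fix E assume E: "E \<in> sets line_measure"
  then have EX: "E \<subseteq> mspace \<rho>" using sets.sets_into_space by fastforce
  have "emeasure line_measure ` {K. K \<subseteq> E \<and> compactin (mtopology_of line_metric) K}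
      = emeasure lborel ` {V. V \<subseteq> g -` E \<and> compact V}" (is "?L = ?R")
  proof (intro equalityI subsetI)
    fix x assume "x \<in> ?L"
    then obtain K where K: "x = emeasure line_measure K" "K \<subseteq> E" "compactin (mtopology_of line_metric) K" by blast
    have "K \<subseteq> mspace \<rho>" using K(2) EX by blast
    then have "compact (g -` K)" "x = emeasure lborel (g -` K)"
      using K by (simp_all add: compactin_vimage_g sets_vimage_g emeasure_line_measure borel_compact)
    then show "x \<in> ?R" using K(2) by blast
  next
    fix x assume "x \<in> ?R"
    then obtain V where V: "x = emeasure lborel V" "V \<subseteq> g -` E" "compact V" by blast
    have "g -` g ` V = V" "g ` V \<subseteq> mspace \<rho>" using inj_g by (auto simp: inj_vimage_image_eq)
    then have "x = emeasure line_measure (g ` V)" "compactin (mtopology_of line_metric) (g ` V)"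
      using V by (simp_all add: compactin_vimage_g sets_vimage_g emeasure_line_measure borel_compact)
    then show "x \<in> ?L" using V(2) by blast
  qed
  moreover have "emeasure line_measure E = (SUP V\<in>{V. V \<subseteq> g -` E \<and> compact V}. emeasure lborel V)"
    using E EX by (subst lborel_inner_SUP[symmetric]) (simp_all add: sets_vimage_g emeasure_line_measure)
  ultimately show "emeasure line_measure E = (SUP K\<in>{K. K \<subseteq> E \<and> compactin (mtopology_of line_metric) K}. emeasure line_measure K)"
    by simp
qed

lemma finite_on_compacts_line_measure: "finite_on_compacts line_metric line_measure"
  unfolding finite_on_compacts_def
proof (intro allI impI)
  fix K assume K: "compactin (mtopology_of line_metric) K"
  then have "K \<subseteq> mspace \<rho>" using compactin_subset_topspace by fastforce
  then show "emeasure line_measure K < \<infinity>"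
    using K emeasure_compact_finite
    by (simp add: compactin_vimage_g sets_vimage_g emeasure_line_measure borel_compact)
qed

lemma haar_line_measure:
  "haar_measure left_invariant line_metric line_group line_measure"
  "haar_measure right_invariant line_metric line_group line_measure"
  "haar_measure two_sided_invariant line_metric line_group line_measure"
  by (simp_all add: haar_measure_def borel_measure_on_def polish_line_group locally_compact_line sets_line_metric
      diffused_line_measure invariant_line_measure outer_regular_line_measure inner_regular_line_measure finite_on_compacts_line_measure)

lemma sigma_finite_line_measure: "sigma_finite_measure line_measure"
proof
  have sets: "g ` {- real n..real n} \<in> sets (metric_borel \<rho>)"
    and vimage: "g -` g ` {- real n..real n} = {- real n..real n}" for n
    using inj_g by (auto simp: sets_vimage_g inj_vimage_image_eq image_subset_iff)
  have "x \<in> (\<Union>n. g ` {- real n..real n})" if "x \<in> mspace \<rho>" for x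
  proof -
    obtain n where "\<bar>f x\<bar> \<le> real n" using real_arch_simple by blast
    then show ?thesis using gf[OF that] by (intro UN_I[of n] image_eqI[of _ _ "f x"]) auto
  qed
  then have "(\<Union>n. g ` {- real n..real n}) = space line_measure" by auto
  then show "\<exists>A. countable A \<and> A \<subseteq> sets line_measure \<and> \<Union> A = space line_measure \<and> (\<forall>a\<in>A. emeasure line_measure a \<noteq> \<infinity>)"
    using sets by (intro exI[of _ "range (\<lambda>n. g ` {- real n..real n})"]) (auto simp: emeasure_line_measure vimage)
qed

lemma non_finite_line_measure: "non_finite line_measure"
proof -
  have "g -` mspace \<rho> = UNIV" by auto
  then show ?thesis
    unfolding non_finite_def by (subst emeasure_line_measure) (simp_all add: sets_vimage_g)
qed

end

theorem theorem3p2: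
  fixes \<rho> :: "'a metric" and \<mu> :: "'a measure"
  assumes "polish_metric \<rho>"
    and "dense_in_itself (mtopology_of \<rho>)"
    and "borel_measure_on \<rho> \<mu>"
    and "diffused \<mu>"
    and "sigma_finite_measure \<mu>"
    and "non_finite \<mu>"
  shows "\<exists>(\<rho>\<^sub>\<phi> :: 'a metric) (G\<^sub>\<phi> :: 'a monoid) (\<mu>' :: 'a measure).
      mspace \<rho>\<^sub>\<phi> = mspace \<rho> \<and> carrier G\<^sub>\<phi> = mspace \<rho> \<and> borel_measure_on \<rho> \<mu>' \<and>
      sets (metric_borel \<rho>\<^sub>\<phi>) = sets (metric_borel \<rho>) \<and>
      (polish_group \<rho>\<^sub>\<phi> G\<^sub>\<phi> \<and> locally_compact_space (mtopology_of \<rho>\<^sub>\<phi>) \<and>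
       \<not> compact_space (mtopology_of \<rho>\<^sub>\<phi>)) \<and>
      equivalent_measures \<mu>' \<mu> \<and>
      (haar_measure two_sided_invariant \<rho>\<^sub>\<phi> G\<^sub>\<phi> \<mu>' \<and>
       haar_measure left_invariant \<rho>\<^sub>\<phi> G\<^sub>\<phi> \<mu>' \<and>
       haar_measure right_invariant \<rho>\<^sub>\<phi> G\<^sub>\<phi> \<mu>' \<and>
       sigma_finite_measure \<mu>' \<and> non_finite \<mu>')"
proof -
  have sets: "sets \<mu> = sets (metric_borel \<rho>)" using assms(3) by (simp add: borel_measure_on_def)
  have space: "space \<mu> = mspace \<rho>" using sets_eq_imp_space_eq[OF sets] by simp
  have meas: "f \<in> borel_measurable \<mu> \<longleftrightarrow> f \<in> borel_measurable (metric_borel \<rho>)"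
    "g \<in> borel \<rightarrow>\<^sub>M \<mu> \<longleftrightarrow> g \<in> borel \<rightarrow>\<^sub>M metric_borel \<rho>" for f :: "'a \<Rightarrow> real" and g :: "real \<Rightarrow> 'a"
    using measurable_cong_sets[OF sets refl] measurable_cong_sets[OF refl sets] by auto
  have "mspace \<rho> \<noteq> {}" using assms(6) space by (auto simp: non_finite_def)
  then obtain f0 :: "'a \<Rightarrow> real" and g0 where 0: "f0 \<in> borel_measurable (metric_borel \<rho>)"
    "g0 \<in> borel \<rightarrow>\<^sub>M metric_borel \<rho>" "\<And>x. x \<in> mspace \<rho> \<Longrightarrow> g0 (f0 x) = x"
    using polish_embeds_null[OF assms(1)] by metis
  have retract: "borel_retract \<mu> (borel :: real measure)"
    unfolding borel_retract_def meas space using 0 by blast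
  have singletons: "{x} \<in> sets \<mu>" if "x \<in> space \<mu>" for x
  proof -
    have "f0 -` {f0 x} \<inter> space (metric_borel \<rho>) = {x}" using that 0(3) space by auto (metis 0(3))
    then show ?thesis using measurable_sets[OF 0(1), of "{f0 x}"] sets by simp
  qed
  have "emeasure \<mu> (space \<mu>) \<noteq> 0" using assms(6) by (simp add: non_finite_def)
  then obtain f :: "'a \<Rightarrow> real" and g where fg': "f \<in> borel_measurable \<mu>" "g \<in> borel \<rightarrow>\<^sub>M \<mu>"
    "\<And>x. x \<in> space \<mu> \<Longrightarrow> g (f x) = x" "\<And>y. f (g y) = y" "null_sets (distr lborel \<mu> g) = null_sets \<mu>"
    using isomorphic_lebesgue[OF retract assms(5,4) _ singletons] by metis
  interpret line_transport \<rho> f g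
    using fg' by unfold_locales (simp_all add: meas space)
  have "line_measure = distr lborel \<mu> g" unfolding line_measure_def by (rule distr_cong) (simp_all add: sets)
  then have "equivalent_measures line_measure \<mu>"
    using fg'(5) by (simp add: equivalent_measures_def absolutely_continuous_def)
  then show ?thesis
    using polish_line_group locally_compact_line not_compact_line sets_line_metric haar_line_measure sigma_finite_line_measure non_finite_line_measure
    by (intro exI[of _ line_metric] exI[of _ line_group] exI[of _ line_measure])
       (simp add: borel_measure_on_def)
qed

end
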